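(* Let $(X,\mathcal{A})$ be a measurable space with a measure $m$, and let $\mathcal{E}\colon L^2(X,m)\to[0,\infty]$ be a proper, lower semicontinuous, convex functional. Then the following assertions are equivalent: (i) $\mathcal{E}$ is a nonlinear Dirichlet form (in the sense of Cipriani / Grillo). (ii) $\mathcal{E}$ is compatible with the normal contraction $x\mapsto x_+=0\vee x$ and with the normal contractions $x\mapsto -\alpha\vee x\wedge\alpha$ for all $\alpha>0$. (iii) $\mathcal{E}$ is compatible with the normal contractions $x\mapsto x\wedge\alpha$ for all $\alpha\geq 0$. (iii)' $\mathcal{E}$ is compatible with the normal contractions $x\mapsto x\wedge\alpha$ for all $\alpha>0$. (iv) $\mathcal{E}$ is compatible with the normal contractions $x\mapsto 0\vee x\wedge\alpha$ for all $\alpha>0$. (All these maps are functions $\mathbb{R}\to\mathbb{R}$.)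
   Context: $L^2(X,m)$ is the real Hilbert space of square-integrable functions. A functional $\mathcal{E}\colon L^2(X,m)\to[0,\infty]$ is proper if $\mathcal{E}(f)<\infty$ for some $f$. A normal contraction is a function $C\colon\mathbb{R}\to\mathbb{R}$ with $C(0)=0$ and $|C(x)-C(y)|\leq|x-y|$ for all $x,y\in\mathbb{R}$; $Cg$ denotes the composition $C\circ g$. The functional $\mathcal{E}$ is compatible with the normal contraction $C$ if for all $f,g\in L^2(X,m)$, $$\mathcal{E}(f+Cg)+\mathcal{E}(f-Cg)\leq\mathcal{E}(f+g)+\mathcal{E}(f-g).$$ Notation: $a\wedge b=\min(a,b)$, $a\vee b=\max(a,b)$, $a_+=a\vee 0$, $a_-=(-a)\vee 0$, applied pointwise to functions. For $a\leq b$, $a\vee x\wedge b=\max(a,\min(x,b))$; in particular $-\alpha\vee x\wedge\alpha$ means $(-\alpha)\vee x\wedge\alpha$. A functional $\mathcal{E}\colon L^2(X,m)\to[0,\infty]$ is a nonlinear Dirichlet form (in the sense of Cipriani / Grillo) if it is proper, lower semicontinuous and convex, and for all $u,v\in L^2(X,m)$ and all $\alpha>0$, $$\mathcal{E}\left(\frac{u+u\wedge v}{2}\right)+\mathcal{E}\left(\frac{v+u\vee v}{2}\right)\leq\mathcal{E}(u)+\mathcal{E}(v)$$ and $$\mathcal{E}(P^1_{2,\alpha}(u,v))+\mathcal{E}(P^2_{2,\alpha}(u,v))\leq\mathcal{E}(u)+\mathcal{E}(v),$$ where $P^1_{2,\alpha}(u,v)=v+\frac12[(u-v+\alpha)_+-(u-v-\alpha)_-]$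 and $P^2_{2,\alpha}(u,v)=u-\frac12[(u-v+\alpha)_+-(u-v-\alpha)_-]$. *)

theory Defs
  imports "HOL-Analysis.Analysis"
begin

text \<open>
  Elements of \<open>L\<^sup>2(X,m)\<close> are represented by square-integrable functions, where \<open>X\<close>, its
  sigma-algebra and \<open>m\<close> are bundled into \<open>M\<close> (no finiteness assumption on the measure). A functional
  on \<open>L\<^sup>2(X,m)\<close> is a functional on representatives that does not distinguish functions
  agreeing almost everywhere; its values outside \<open>L2 M\<close> are never used.
\<close>

definition L2 :: "'a measure \<Rightarrow> ('a \<Rightarrow> real) set" where
  "L2 M = {f \<in> borel_measurable M. integrable M (\<lambda>x. (f x)\<^sup>2)}"

definition L2_norm :: "'a measure \<Rightarrow> ('a \<Rightarrow> real) \<Rightarrow> real" where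
  "L2_norm M f = sqrt (\<integral>x. (f x)\<^sup>2 \<partial>M)"

definition L2_functional :: "'a measure \<Rightarrow> (('a \<Rightarrow> real) \<Rightarrow> ennreal) \<Rightarrow> bool" where
  "L2_functional M E \<longleftrightarrow>
     (\<forall>f\<in>L2 M. \<forall>g\<in>L2 M. (AE x in M. f x = g x) \<longrightarrow> E f = E g)"

definition proper_functional :: "'a measure \<Rightarrow> (('a \<Rightarrow> real) \<Rightarrow> ennreal) \<Rightarrow> bool" where
  "proper_functional M E \<longleftrightarrow> (\<exists>f\<in>L2 M. E f < \<infinity>)"

definition lsc_functional :: "'a measure \<Rightarrow> (('a \<Rightarrow> real) \<Rightarrow> ennreal) \<Rightarrow> bool" where
  "lsc_functional M E \<longleftrightarrow>
     (\<forall>f\<in>L2 M. \<forall>c<E f. \<exists>\<delta>>0. \<forall>g\<in>L2 M. L2_norm M (\<lambda>x. g x - f x) < \<delta> \<longrightarrow> c < E g)"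

text \<open>In \<^typ>\<open>ennreal\<close> we have \<open>0 * \<infinity> = 0\<close>, so the endpoints \<open>t = 0\<close> and \<open>t = 1\<close> impose nothing.\<close>

definition convex_functional :: "'a measure \<Rightarrow> (('a \<Rightarrow> real) \<Rightarrow> ennreal) \<Rightarrow> bool" where
  "convex_functional M E \<longleftrightarrow>
     (\<forall>f\<in>L2 M. \<forall>g\<in>L2 M. \<forall>t\<in>{0..1::real}.
        E (\<lambda>x. (1 - t) * f x + t * g x) \<le> ennreal (1 - t) * E f + ennreal t * E g)"

definition normal_contraction :: "(real \<Rightarrow> real) \<Rightarrow> bool" where
  "normal_contraction C \<longleftrightarrow> C 0 = 0 \<and> (\<forall>x y. \<bar>C x - C y\<bar> \<le> \<bar>x - y\<bar>)"

definition compatible :: "'a measure \<Rightarrow> (('a \<Rightarrow> real) \<Rightarrow> ennreal) \<Rightarrow> (real \<Rightarrow> real) \<Rightarrow> bool" where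
  "compatible M E C \<longleftrightarrow> normal_contraction C \<and>
     (\<forall>f\<in>L2 M. \<forall>g\<in>L2 M.
        E (\<lambda>x. f x + C (g x)) + E (\<lambda>x. f x - C (g x))
          \<le> E (\<lambda>x. f x + g x) + E (\<lambda>x. f x - g x))"

definition P1 :: "real \<Rightarrow> ('a \<Rightarrow> real) \<Rightarrow> ('a \<Rightarrow> real) \<Rightarrow> 'a \<Rightarrow> real" where
  "P1 \<alpha> u v = (\<lambda>x. v x + 1/2 * (max (u x - v x + \<alpha>) 0 - max (- (u x - v x - \<alpha>)) 0))"

definition P2 :: "real \<Rightarrow> ('a \<Rightarrow> real) \<Rightarrow> ('a \<Rightarrow> real) \<Rightarrow> 'a \<Rightarrow> real" where
  "P2 \<alpha> u v = (\<lambda>x. u x - 1/2 * (max (u x - v x + \<alpha>) 0 - max (- (u x - v x - \<alpha>)) 0))"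

definition nonlinear_Dirichlet_form :: "'a measure \<Rightarrow> (('a \<Rightarrow> real) \<Rightarrow> ennreal) \<Rightarrow> bool" where
  "nonlinear_Dirichlet_form M E \<longleftrightarrow>
     L2_functional M E \<and> proper_functional M E \<and> lsc_functional M E \<and> convex_functional M E \<and>
     (\<forall>u\<in>L2 M. \<forall>v\<in>L2 M.
        E (\<lambda>x. (u x + min (u x) (v x)) / 2) + E (\<lambda>x. (v x + max (u x) (v x)) / 2)
          \<le> E u + E v) \<and>
     (\<forall>u\<in>L2 M. \<forall>v\<in>L2 M. \<forall>\<alpha>>0.
        E (P1 \<alpha> u v) + E (P2 \<alpha> u v) \<le> E u + E v)"

end

theory Submission
  imports Defs
begin

text \<open>
  Substituting \<open>u = f + g\<close> and \<open>v = f - g\<close> turns the two inequalities in the definition of a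
  nonlinear Dirichlet form into compatibility with \<open>x \<mapsto> x\<^sub>+\<close> and with the symmetric truncations,
  so (i) and (ii) are the same statement. The contractions that \<open>E\<close> is compatible with are closed
  under composition, under \<open>C \<mapsto> (x \<mapsto> - C (- x))\<close> and, because \<open>E\<close> is lower semicontinuous, under
  pointwise limits (\<open>compatible_comp\<close>, \<open>compatible_reflect\<close>, \<open>compatible_limit\<close>). This yields
  (ii) \<open>\<Longrightarrow>\<close> (iv), (iii)' \<open>\<Longrightarrow>\<close> (iii) and (iii) \<open>\<Longrightarrow>\<close> (ii).

  The remaining implication (iv) \<open>\<Longrightarrow>\<close> (iii)' needs more than these closure properties, because the
  maps in (iv) destroy the negative part of \<open>g\<close>, which \<open>x \<and> \<alpha>\<close> keeps. The way out is submodularity, \<open>E (u \<and> v) + E (u \<or> v) \<le> E u + E v\<close>, which follows from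
  compatibility with \<open>x\<^sub>+\<close> alone (\<open>submodular_of_compatible_pos_part\<close>). If \<open>E\<close> is smooth,
  compatibility with \<open>x\<^sub>+\<close> says that the derivative of \<open>E\<close> in a nonnegative direction decreases when
  the base point is raised on the set where that direction vanishes, and integrating this gives
  submodularity. In general the integration is replaced by a telescoping sum over a dyadic grid
  (\<open>dyadic_exchange\<close>), and lower semicontinuity removes the mesh size.

  Submodularity says that the change of \<open>E\<close> caused by cutting \<open>g\<close> at level \<open>\<alpha>\<close> can be compared with
  the change caused by the same cut applied to \<open>g\<^sub>+\<close>. For the nonnegative function \<open>g\<^sub>+\<close> the cut
  is one of the contractions in (iv), and so the inequality for \<open>x \<and> \<alpha>\<close> follows
  (\<open>compatible_min_of_compatible_interval_cut\<close>).
\<close>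

section \<open>Square-integrable functions\<close>

lemma L2_dominated:
  assumes "g \<in> L2 M" "f \<in> borel_measurable M" "\<And>x. \<bar>f x\<bar> \<le> \<bar>g x\<bar>"
  shows "f \<in> L2 M"
proof -
  have "integrable M (\<lambda>x. (f x)\<^sup>2)"
  proof (rule Bochner_Integration.integrable_bound)
    show "integrable M (\<lambda>x. (g x)\<^sup>2)" using assms(1) by (simp add: L2_def)
    show "AE x in M. norm ((f x)\<^sup>2) \<le> norm ((g x)\<^sup>2)"
      using assms(3) by (simp add: abs_le_square_iff)
  qed (use assms(2) in measurable)
  then show ?thesis using assms(2) by (simp add: L2_def)
qed

lemma L2_measurable: "f \<in> L2 M \<Longrightarrow> f \<in> borel_measurable M"
  by (simp add: L2_def)

lemma L2_scale:
  assumes "f \<in> L2 M" shows "(\<lambda>x. c * f x) \<in> L2 M"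
  using assms by (auto simp: L2_def power_mult_distrib)

lemma L2_add:
  assumes f: "f \<in> L2 M" and g: "g \<in> L2 M" shows "(\<lambda>x. f x + g x) \<in> L2 M"
proof -
  note [measurable] = L2_measurable[OF f] L2_measurable[OF g]
  have "integrable M (\<lambda>x. (f x + g x)\<^sup>2)"
  proof (rule Bochner_Integration.integrable_bound)
    show "integrable M (\<lambda>x. 2 * (f x)\<^sup>2 + 2 * (g x)\<^sup>2)"
      using f g by (simp add: L2_def)
    have "(f x + g x)\<^sup>2 \<le> 2 * (f x)\<^sup>2 + 2 * (g x)\<^sup>2" for x
      using zero_le_power2[of "f x - g x"] by (simp add: power2_sum power2_diff)
    then show "AE x in M. norm ((f x + g x)\<^sup>2) \<le> norm (2 * (f x)\<^sup>2 + 2 * (g x)\<^sup>2)"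
      by simp
  qed measurable
  then show ?thesis by (simp add: L2_def)
qed

lemma L2_diff:
  assumes "f \<in> L2 M" "g \<in> L2 M" shows "(\<lambda>x. f x - g x) \<in> L2 M"
  using L2_add[OF assms(1) L2_scale[OF assms(2), of "-1"]] by simp

lemma L2_uminus:
  assumes "f \<in> L2 M" shows "(\<lambda>x. - f x) \<in> L2 M"
  using L2_scale[OF assms, of "-1"] by simp

lemma normal_contraction_abs_le: "normal_contraction C \<Longrightarrow> \<bar>C x\<bar> \<le> \<bar>x\<bar>"
  unfolding normal_contraction_def by (metis diff_zero)

lemma normal_contraction_measurable:
  assumes "normal_contraction C" shows "C \<in> borel_measurable borel"
proof -
  have "1-lipschitz_on UNIV C"
    using assms by (auto simp: lipschitz_on_def normal_contraction_def dist_real_def)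
  then show ?thesis
    by (intro borel_measurable_continuous_onI lipschitz_on_continuous_on)
qed

lemma L2_contraction:
  assumes "normal_contraction C" "g \<in> L2 M" shows "(\<lambda>x. C (g x)) \<in> L2 M"
proof (rule L2_dominated[OF assms(2)])
  show "(\<lambda>x. C (g x)) \<in> borel_measurable M"
    using measurable_compose[OF L2_measurable[OF assms(2)] normal_contraction_measurable[OF assms(1)]] .
qed (use assms(1) normal_contraction_abs_le in auto)

lemma L2_norm_tendsto_0:
  assumes g: "g \<in> L2 M" and meas: "\<And>n. h n \<in> borel_measurable M"
    and bound: "\<And>n x. \<bar>h n x\<bar> \<le> \<bar>g x\<bar>" and lim: "\<And>x. (\<lambda>n. h n x) \<longlonglongrightarrow> 0"
  shows "(\<lambda>n. L2_norm M (h n)) \<longlonglongrightarrow> 0"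
proof -
  note [measurable] = meas
  have "(\<lambda>n. \<integral>x. (h n x)\<^sup>2 \<partial>M) \<longlonglongrightarrow> (\<integral>x. 0 \<partial>M)"
  proof (rule integral_dominated_convergence[where w = "\<lambda>x. (g x)\<^sup>2"])
    show "integrable M (\<lambda>x. (g x)\<^sup>2)" using g by (simp add: L2_def)
    show "AE x in M. (\<lambda>n. (h n x)\<^sup>2) \<longlonglongrightarrow> 0"
      using tendsto_power[OF lim, where n = 2] by simp
    show "AE x in M. norm ((h n x)\<^sup>2) \<le> (g x)\<^sup>2" for n
      using bound by (simp add: abs_le_square_iff)
  qed measurable
  then have "(\<lambda>n. sqrt (\<integral>x. (h n x)\<^sup>2 \<partial>M)) \<longlonglongrightarrow> sqrt 0"
    by (intro tendsto_real_sqrt) simp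
  then show ?thesis by (simp add: L2_norm_def)
qed

section \<open>Lower semicontinuity along dominated sequences\<close>

lemma lsc_le_liminf:
  assumes lsc: "lsc_functional M E" and f: "f \<in> L2 M" and F: "\<And>n. F n \<in> L2 M" and g: "g \<in> L2 M"
    and bound: "\<And>n x. \<bar>F n x - f x\<bar> \<le> \<bar>g x\<bar>" and lim: "\<And>x. (\<lambda>n. F n x) \<longlonglongrightarrow> f x"
  shows "E f \<le> liminf (\<lambda>n. E (F n))"
proof (subst le_Liminf_iff, intro allI impI)
  fix c assume "c < E f"
  then obtain \<delta> where \<delta>: "\<delta> > 0"
    "\<And>g. g \<in> L2 M \<Longrightarrow> L2_norm M (\<lambda>x. g x - f x) < \<delta> \<Longrightarrow> c < E g"
    using lsc f unfolding lsc_functional_def by blast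
  have "(\<lambda>n. L2_norm M (\<lambda>x. F n x - f x)) \<longlonglongrightarrow> 0"
  proof (rule L2_norm_tendsto_0[OF g _ bound])
    show "(\<lambda>x. F n x - f x) \<in> borel_measurable M" for n
      using F f by (intro borel_measurable_diff L2_measurable)
    show "(\<lambda>n. F n x - f x) \<longlonglongrightarrow> 0" for x
      using lim[of x] by (rule LIM_zero)
  qed
  then have "eventually (\<lambda>n. L2_norm M (\<lambda>x. F n x - f x) < \<delta>) sequentially"
    using \<delta>(1) by (rule order_tendstoD)
  then show "eventually (\<lambda>n. c < E (F n)) sequentially"
    by eventually_elim (use \<delta>(2) F in blast)
qed

lemma ennreal_liminf_add_le:
  fixes a b :: "nat \<Rightarrow> ennreal"
  shows "liminf a + liminf b \<le> liminf (\<lambda>n. a n + b n)"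
  including ennreal.lifting
  by transfer (simp add: Liminf_add_le)

text \<open>
  All limits below are taken in sums of two values of \<open>E\<close>, hence the form of this lemma.
\<close>

lemma lsc_sum_le:
  assumes lsc: "lsc_functional M E"
    and f: "f \<in> L2 M" "f' \<in> L2 M" and F: "\<And>n. F n \<in> L2 M" "\<And>n. F' n \<in> L2 M" and g: "g \<in> L2 M"
    and bound: "\<And>n x. \<bar>F n x - f x\<bar> \<le> \<bar>g x\<bar>" "\<And>n x. \<bar>F' n x - f' x\<bar> \<le> \<bar>g x\<bar>"
    and lim: "\<And>x. (\<lambda>n. F n x) \<longlonglongrightarrow> f x" "\<And>x. (\<lambda>n. F' n x) \<longlonglongrightarrow> f' x"
    and le: "\<And>n. E (F n) + E (F' n) \<le> c"
  shows "E f + E f' \<le> c"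
proof -
  have "E f + E f' \<le> liminf (\<lambda>n. E (F n)) + liminf (\<lambda>n. E (F' n))"
    by (intro add_mono lsc_le_liminf[OF lsc f(1) F(1) g bound(1) lim(1)]
        lsc_le_liminf[OF lsc f(2) F(2) g bound(2) lim(2)])
  also have "\<dots> \<le> liminf (\<lambda>n. E (F n) + E (F' n))"
    by (rule ennreal_liminf_add_le)
  also have "\<dots> \<le> c"
    by (rule Liminf_le) (simp_all add: le)
  finally show ?thesis .
qed

section \<open>Closure properties of the compatible contractions\<close>

lemma compatibleD:
  assumes "compatible M E C" "f \<in> L2 M" "g \<in> L2 M"
  shows "E (\<lambda>x. f x + C (g x)) + E (\<lambda>x. f x - C (g x)) \<le> E (\<lambda>x. f x + g x) + E (\<lambda>x. f x - g x)"
  using assms unfolding compatible_def by blast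

lemma compatible_comp:
  assumes C: "compatible M E C" and D: "compatible M E D"
  shows "compatible M E (\<lambda>x. C (D x))"
  unfolding compatible_def
proof (intro conjI ballI)
  have *: "normal_contraction C" "normal_contraction D" using C D by (auto simp: compatible_def)
  then show "normal_contraction (\<lambda>x. C (D x))"
    unfolding normal_contraction_def by (metis order_trans)
  fix f g assume fg: "f \<in> L2 M" "g \<in> L2 M"
  have "E (\<lambda>x. f x + C (D (g x))) + E (\<lambda>x. f x - C (D (g x)))
      \<le> E (\<lambda>x. f x + D (g x)) + E (\<lambda>x. f x - D (g x))"
    using compatibleD[OF C fg(1) L2_contraction[OF *(2) fg(2)]] .
  also have "\<dots> \<le> E (\<lambda>x. f x + g x) + E (\<lambda>x. f x - g x)"
    by (rule compatibleD[OF D fg])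
  finally show "E (\<lambda>x. f x + C (D (g x))) + E (\<lambda>x. f x - C (D (g x))) \<le> \<dots>" .
qed

text \<open>Both sides of the compatibility inequality are even in \<open>g\<close> and in \<open>C\<close>.\<close>

lemma compatible_reflect:
  assumes C: "compatible M E C"
  shows "compatible M E (\<lambda>x. - C (- x))"
  unfolding compatible_def
proof (intro conjI ballI)
  show "normal_contraction (\<lambda>x. - C (- x))"
    unfolding normal_contraction_def
  proof (intro conjI allI)
    show "- C (- 0) = 0" using C by (simp add: compatible_def normal_contraction_def)
    fix x y
    have "\<bar>C (- x) - C (- y)\<bar> \<le> \<bar>- x - - y\<bar>"
      using C unfolding compatible_def normal_contraction_def by blast
    then show "\<bar>- C (- x) - - C (- y)\<bar> \<le> \<bar>x - y\<bar>" by linarith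
  qed
  fix f g assume "f \<in> L2 M" "g \<in> L2 M"
  then show "E (\<lambda>x. f x + - C (- g x)) + E (\<lambda>x. f x - - C (- g x))
      \<le> E (\<lambda>x. f x + g x) + E (\<lambda>x. f x - g x)"
    using compatibleD[OF C _ L2_uminus, of f g] by (simp add: add.commute)
qed

lemma compatible_limit:
  assumes lsc: "lsc_functional M E" and comp: "\<And>n. compatible M E (C n)"
    and lim: "\<And>x. (\<lambda>n. C n x) \<longlonglongrightarrow> D x"
  shows "compatible M E D"
  unfolding compatible_def
proof (intro conjI ballI)
  have nc: "normal_contraction (C n)" for n using comp by (simp add: compatible_def)
  show ncD: "normal_contraction D"
    unfolding normal_contraction_def
  proof (intro conjI allI)
    show "D 0 = 0"
      using nc lim[of 0] LIMSEQ_unique[OF _ tendsto_const] by (simp add: normal_contraction_def)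
    show "\<bar>D x - D y\<bar> \<le> \<bar>x - y\<bar>" for x y
    proof (rule LIMSEQ_le_const2)
      show "(\<lambda>n. \<bar>C n x - C n y\<bar>) \<longlonglongrightarrow> \<bar>D x - D y\<bar>" by (intro tendsto_intros lim)
    qed (use nc in \<open>auto simp: normal_contraction_def\<close>)
  qed
  fix f g assume f: "f \<in> L2 M" and g: "g \<in> L2 M"
  have bound: "\<bar>C n y - D y\<bar> \<le> \<bar>2 * y\<bar>" for n y
    using normal_contraction_abs_le[OF nc[of n], of y] normal_contraction_abs_le[OF ncD, of y] by linarith
  show "E (\<lambda>x. f x + D (g x)) + E (\<lambda>x. f x - D (g x)) \<le> E (\<lambda>x. f x + g x) + E (\<lambda>x. f x - g x)"
  proof (rule lsc_sum_le[OF lsc, where g = "\<lambda>x. 2 * g x"])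
    show "\<bar>f x + C n (g x) - (f x + D (g x))\<bar> \<le> \<bar>2 * g x\<bar>"
      "\<bar>f x - C n (g x) - (f x - D (g x))\<bar> \<le> \<bar>2 * g x\<bar>" for n x
      using bound[of n "g x"] by linarith+
    show "E (\<lambda>x. f x + C n (g x)) + E (\<lambda>x. f x - C n (g x))
        \<le> E (\<lambda>x. f x + g x) + E (\<lambda>x. f x - g x)" for n
      by (rule compatibleD[OF comp f g])
    show "(\<lambda>n. f x + C n (g x)) \<longlonglongrightarrow> f x + D (g x)" "(\<lambda>n. f x - C n (g x)) \<longlonglongrightarrow> f x - D (g x)" for x
      by (rule tendsto_add tendsto_diff, rule tendsto_const, rule lim)+
  qed (rule L2_add[OF f L2_contraction[OF ncD g]] L2_diff[OF f L2_contraction[OF ncD g]]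
      L2_add[OF f L2_contraction[OF nc g]] L2_diff[OF f L2_contraction[OF nc g]] L2_scale[OF g])+
qed

section \<open>Submodularity\<close>

lemma ennreal_exchange_cancel:
  fixes a b b' c :: ennreal
  assumes "a + b \<le> c + b'" "b' \<le> b" "b < \<infinity>"
  shows "a \<le> c"
proof -
  have "b + a \<le> b + c"
    using order_trans[OF assms(1) add_left_mono[OF assms(2)]] by (simp only: add.commute)
  then show ?thesis using assms(3) by (auto simp: ennreal_add_left_cancel_le)
qed

text \<open>
  The hypothesis with \<open>s = m - h\<close> and \<open>t = m + h\<close> compares the increment of \<open>\<phi>\<close> on \<open>[m - h, m]\<close> with
  that of \<open>\<psi>\<close> on \<open>[m, m + h]\<close>. Summing over a grid of mesh \<open>h\<close> compares increments over the whole
  interval, up to one step of the grid. Halving the interval organises the sum so that all values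
  to be cancelled are finite as soon as the right-hand side is.
\<close>

lemma dyadic_exchange:
  fixes \<phi> \<psi> :: "real \<Rightarrow> ennreal"
  assumes mid: "\<And>s t. s \<le> t \<Longrightarrow> \<phi> ((s + t) / 2) + \<psi> ((s + t) / 2) \<le> \<phi> s + \<psi> t"
    and "s \<le> t"
  shows "\<phi> (t - (t - s) / 2 ^ n) + \<psi> (s + (t - s) / 2 ^ n) \<le> \<phi> s + \<psi> t"
  using \<open>s \<le> t\<close>
proof (induction n arbitrary: s t)
  case 0
  then show ?case by simp
next
  case (Suc n)
  define m where "m = (s + t) / 2"
  define h where "h = (t - s) / 2 ^ Suc n"
  have m: "s \<le> m" "m \<le> t" using Suc.prems by (auto simp: m_def)
  have h: "(m - s) / 2 ^ n = h" "(t - m) / 2 ^ n = h"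
    by (simp_all add: m_def h_def field_simps)
  have "0 \<le> h" using Suc.prems by (simp add: h_def)
  have left: "\<phi> (m - h) + \<psi> (s + h) \<le> \<phi> s + \<psi> m"
    using Suc.IH[OF m(1)] by (simp add: h)
  have right: "\<phi> (t - h) + \<psi> (m + h) \<le> \<phi> m + \<psi> t"
    using Suc.IH[OF m(2)] by (simp add: h)
  have glue: "\<phi> m + \<psi> m \<le> \<phi> (m - h) + \<psi> (m + h)"
    using mid[of "m - h" "m + h"] \<open>0 \<le> h\<close> by simp
  have centre: "\<phi> m + \<psi> m \<le> \<phi> s + \<psi> t"
    using mid[OF Suc.prems] by (simp add: m_def)
  have "\<phi> (t - h) + \<psi> (s + h) \<le> \<phi> s + \<psi> t"
  proof (cases "\<phi> s + \<psi> t < \<infinity>")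
    case True
    then have "\<phi> m + \<psi> m < \<infinity>" using centre by (rule le_less_trans[rotated])
    with True have fin: "\<phi> s + \<psi> m < \<infinity>" "\<phi> m + \<psi> t < \<infinity>" by auto
    have "\<phi> (m - h) + \<psi> (m + h) < \<infinity>"
      using le_less_trans[OF left fin(1)] le_less_trans[OF right fin(2)] by auto
    moreover have "(\<phi> (t - h) + \<psi> (s + h)) + (\<phi> (m - h) + \<psi> (m + h)) \<le> (\<phi> s + \<psi> t) + (\<phi> m + \<psi> m)"
      using add_mono[OF left right] by (simp add: ac_simps)
    ultimately show ?thesis
      using ennreal_exchange_cancel[OF _ glue] by blast
  next
    case False
    then show ?thesis by (auto simp: less_top[symmetric])
  qed
  then show ?case by (simp add: h_def)
qed

text \<open>
  With \<open>d = v - u\<close>, the functions \<open>u + t d\<^sub>+\<close> and \<open>u - d\<^sub>- + t d\<^sub>+\<close> lead from \<open>u\<close> to \<open>u \<or> v\<close> and from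
  \<open>u \<and> v\<close> to \<open>v\<close> as \<open>t\<close> runs from 0 to 1. Compatibility with \<open>x\<^sub>+\<close>, applied to the first path at time
  \<open>s\<close> and the second at time \<open>t \<ge> s\<close>, moves both to time \<open>(s + t) / 2\<close>: the two functions are ordered
  one way where \<open>d < 0\<close> and the other way where \<open>d > 0\<close>, and the positive part keeps the former
  difference and averages the latter. The exchange over the grid nearly swaps the end points.
\<close>

lemma submodular_of_compatible_pos_part:
  assumes lsc: "lsc_functional M E" and pos: "compatible M E (\<lambda>x. max 0 x)"
    and u: "u \<in> L2 M" and v: "v \<in> L2 M"
  shows "E (\<lambda>x. max (u x) (v x)) + E (\<lambda>x. min (u x) (v x)) \<le> E u + E v"
proof -
  define p where "p x = max 0 (v x - u x)" for x
  define q where "q x = max 0 (u x - v x)" for x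
  have nc: "normal_contraction (\<lambda>x. max 0 x)" using pos by (simp add: compatible_def)
  have pq: "p \<in> L2 M" "q \<in> L2 M"
    unfolding p_def[abs_def] q_def[abs_def] by (intro L2_contraction[OF nc] L2_diff u v)+
  define \<phi> where "\<phi> t = E (\<lambda>x. u x + t * p x)" for t
  define \<psi> where "\<psi> t = E (\<lambda>x. u x - q x + t * p x)" for t
  have mid: "\<phi> ((s + t) / 2) + \<psi> ((s + t) / 2) \<le> \<phi> s + \<psi> t" if "s \<le> t" for s t
  proof -
    define f where "f x = u x + (s + t) / 2 * p x - 1 / 2 * q x" for x
    define g where "g x = 1 / 2 * q x - (t - s) / 2 * p x" for x
    have fg: "f \<in> L2 M" "g \<in> L2 M"
      unfolding f_def[abs_def] g_def[abs_def] by (intro L2_diff L2_add L2_scale u pq)+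
    have gpos: "max 0 (g x) = q x / 2" for x
    proof (cases "u x \<le> v x")
      case True
      then have "q x = 0" "p x \<ge> 0" by (auto simp: p_def q_def)
      moreover from this have "0 \<le> (t - s) / 2 * p x" using that by simp
      ultimately show ?thesis by (simp add: g_def)
    next
      case False
      then have "p x = 0" "q x \<ge> 0" by (auto simp: p_def q_def)
      then show ?thesis by (simp add: g_def max_def)
    qed
    have "(\<lambda>x. f x + max 0 (g x)) = (\<lambda>x. u x + (s + t) / 2 * p x)"
      "(\<lambda>x. f x - max 0 (g x)) = (\<lambda>x. u x - q x + (s + t) / 2 * p x)"
      by (simp_all only: gpos) (simp_all add: f_def algebra_simps)
    moreover have "(\<lambda>x. f x + g x) = (\<lambda>x. u x + s * p x)"
      "(\<lambda>x. f x - g x) = (\<lambda>x. u x - q x + t * p x)"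
      by (simp_all add: f_def g_def fun_eq_iff) (simp_all add: field_simps)
    ultimately show ?thesis
      using compatibleD[OF pos fg] by (simp add: \<phi>_def \<psi>_def)
  qed
  have ends: "(\<lambda>x. u x + 0 * p x) = u" "(\<lambda>x. u x - q x + 1 * p x) = v"
    by (auto simp: p_def q_def max_def)
  have step: "\<phi> (1 - 1 / 2 ^ n) + \<psi> (0 + 1 / 2 ^ n) \<le> E u + E v" for n
    using dyadic_exchange[of \<phi> \<psi> 0 1 n, OF mid] ends by (simp add: \<phi>_def \<psi>_def)
  have mesh: "(\<lambda>n. (1 / 2 ^ n :: real)) \<longlonglongrightarrow> 0"
    using LIMSEQ_power_zero[of "1 / 2 :: real"] by (simp add: power_one_over)
  have "E (\<lambda>x. u x + p x) + E (\<lambda>x. u x - q x) \<le> E u + E v"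
  proof (rule lsc_sum_le[OF lsc, where g = p])
    show "(\<lambda>n. u x + (1 - 1 / 2 ^ n) * p x) \<longlonglongrightarrow> u x + p x" for x
      using tendsto_add[OF tendsto_const tendsto_mult[OF tendsto_diff[OF tendsto_const mesh] tendsto_const],
          of "u x" 1 "p x"] by simp
    show "(\<lambda>n. u x - q x + 1 / 2 ^ n * p x) \<longlonglongrightarrow> u x - q x" for x
      using tendsto_add[OF tendsto_const tendsto_mult[OF mesh tendsto_const], of "u x - q x" "p x"] by simp
    have small: "\<bar>1 / 2 ^ n * p x\<bar> \<le> \<bar>p x\<bar>" for n x
      using mult_left_mono[of 1 "2 ^ n" "\<bar>p x\<bar>"] by (simp add: divide_le_eq)
    show "\<bar>u x + (1 - 1 / 2 ^ n) * p x - (u x + p x)\<bar> \<le> \<bar>p x\<bar>" for n x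
    proof -
      have "u x + (1 - 1 / 2 ^ n) * p x - (u x + p x) = - (1 / 2 ^ n * p x)"
        by (simp add: algebra_simps)
      then show ?thesis using small[of n x] by simp
    qed
    show "\<bar>u x - q x + 1 / 2 ^ n * p x - (u x - q x)\<bar> \<le> \<bar>p x\<bar>" for n x
      using small[of n x] by simp
    show "E (\<lambda>x. u x + (1 - 1 / 2 ^ n) * p x) + E (\<lambda>x. u x - q x + 1 / 2 ^ n * p x) \<le> E u + E v" for n
      using step[of n] by (simp add: \<phi>_def \<psi>_def)
  qed (intro L2_add L2_diff L2_scale u pq)+
  moreover have "(\<lambda>x. u x + p x) = (\<lambda>x. max (u x) (v x))" "(\<lambda>x. u x - q x) = (\<lambda>x. min (u x) (v x))"
    by (auto simp: p_def q_def max_def min_def)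
  ultimately show ?thesis by simp
qed

section \<open>Passing between the families of contractions\<close>

lemma compatible_pos_part_of_compatible_interval_cut:
  assumes lsc: "lsc_functional M E"
    and cut: "\<And>\<alpha>. \<alpha> > 0 \<Longrightarrow> compatible M E (\<lambda>x. max 0 (min x \<alpha>))"
  shows "compatible M E (\<lambda>x. max 0 x)"
proof (rule compatible_limit[OF lsc])
  show "compatible M E (\<lambda>x. max 0 (min x (real (Suc n))))" for n
    by (rule cut) simp
  show "(\<lambda>n. max 0 (min x (real (Suc n)))) \<longlonglongrightarrow> max 0 x" for x
  proof (rule tendsto_eventually)
    have "x \<le> real (Suc n)" if "n \<ge> nat \<lceil>x\<rceil>" for n using that by linarith
    then show "eventually (\<lambda>n. max 0 (min x (real (Suc n))) = max 0 x) sequentially"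
      unfolding eventually_sequentially by (metis min.absorb1)
  qed
qed

text \<open>
  Cutting \<open>g\<close> at \<open>\<alpha>\<close> changes \<open>f + g\<close> only where \<open>g > \<alpha>\<close>. Submodularity bounds the effect of this
  change from below by its effect at \<open>f + g\<^sub>+\<close>, which differs from \<open>f + g\<close> only where \<open>g < 0\<close>;
  likewise for \<open>f - g\<close> and \<open>f - g\<^sub>+\<close>. The two effects at \<open>f \<plusminus> g\<^sub>+\<close> add up to something nonnegative, by
  compatibility with the cut applied to the nonnegative function \<open>g\<^sub>+\<close>.
\<close>

lemma compatible_min_of_compatible_interval_cut:
  assumes lsc: "lsc_functional M E"
    and pos: "compatible M E (\<lambda>x. max 0 x)"
    and cut: "compatible M E (\<lambda>x. max 0 (min x \<alpha>))"
    and \<alpha>: "\<alpha> \<ge> 0"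
  shows "compatible M E (\<lambda>x. min x \<alpha>)"
  unfolding compatible_def
proof (intro conjI ballI)
  show "normal_contraction (\<lambda>x. min x \<alpha>)"
    using \<alpha> by (auto simp: normal_contraction_def min_def)
  fix f g assume f: "f \<in> L2 M" and g: "g \<in> L2 M"
  define r where "r x = max 0 (g x)" for x
  define c where "c x = max 0 (min (g x) \<alpha>)" for x
  have r: "r \<in> L2 M"
    unfolding r_def[abs_def] using pos g L2_contraction[where C = "\<lambda>x. max 0 x"]
    by (simp add: compatible_def)
  have c: "c \<in> L2 M"
    unfolding c_def[abs_def] using cut g L2_contraction[where C = "\<lambda>x. max 0 (min x \<alpha>)"]
    by (simp add: compatible_def)
  have c_eq: "max 0 (min (r x) \<alpha>) = c x" for x
    using \<alpha> by (auto simp: r_def c_def)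
  have upper: "E (\<lambda>x. f x + r x) + E (\<lambda>x. f x + min (g x) \<alpha>) \<le> E (\<lambda>x. f x + g x) + E (\<lambda>x. f x + c x)"
  proof -
    have "(\<lambda>x. max (f x + g x) (f x + c x)) = (\<lambda>x. f x + r x)"
      "(\<lambda>x. min (f x + g x) (f x + c x)) = (\<lambda>x. f x + min (g x) \<alpha>)"
      using \<alpha> by (auto simp: r_def c_def max_def min_def)
    then show ?thesis
      using submodular_of_compatible_pos_part[OF lsc pos L2_add[OF f g] L2_add[OF f c]] by simp
  qed
  have lower: "E (\<lambda>x. f x - r x) + E (\<lambda>x. f x - min (g x) \<alpha>) \<le> E (\<lambda>x. f x - g x) + E (\<lambda>x. f x - c x)"
  proof -
    have "(\<lambda>x. max (f x - g x) (f x - c x)) = (\<lambda>x. f x - min (g x) \<alpha>)"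
      "(\<lambda>x. min (f x - g x) (f x - c x)) = (\<lambda>x. f x - r x)"
      using \<alpha> by (auto simp: r_def c_def max_def min_def)
    then show ?thesis
      using submodular_of_compatible_pos_part[OF lsc pos L2_diff[OF f g] L2_diff[OF f c]]
      by (simp add: add.commute)
  qed
  have cut_r: "E (\<lambda>x. f x + c x) + E (\<lambda>x. f x - c x) \<le> E (\<lambda>x. f x + r x) + E (\<lambda>x. f x - r x)"
    using compatibleD[OF cut f r] by (simp add: c_eq)
  have pos_g: "E (\<lambda>x. f x + r x) + E (\<lambda>x. f x - r x) \<le> E (\<lambda>x. f x + g x) + E (\<lambda>x. f x - g x)"
    using compatibleD[OF pos f g] by (simp add: r_def)
  show "E (\<lambda>x. f x + min (g x) \<alpha>) + E (\<lambda>x. f x - min (g x) \<alpha>)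
      \<le> E (\<lambda>x. f x + g x) + E (\<lambda>x. f x - g x)"
  proof (cases "E (\<lambda>x. f x + g x) + E (\<lambda>x. f x - g x) < \<infinity>")
    case True
    show ?thesis
    proof (rule ennreal_exchange_cancel[OF _ cut_r le_less_trans[OF pos_g True]])
      show "E (\<lambda>x. f x + min (g x) \<alpha>) + E (\<lambda>x. f x - min (g x) \<alpha>)
          + (E (\<lambda>x. f x + r x) + E (\<lambda>x. f x - r x))
        \<le> E (\<lambda>x. f x + g x) + E (\<lambda>x. f x - g x) + (E (\<lambda>x. f x + c x) + E (\<lambda>x. f x - c x))"
        using add_mono[OF upper lower] by (simp add: ac_simps)
    qed
  next
    case False
    then show ?thesis by (auto simp: less_top[symmetric])
  qed
qed

lemma compatible_min_zero:
  assumes lsc: "lsc_functional M E" and "\<And>\<alpha>. \<alpha> > 0 \<Longrightarrow> compatible M E (\<lambda>x. min x \<alpha>)"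
  shows "compatible M E (\<lambda>x. min x 0)"
proof (rule compatible_limit[OF lsc])
  show "compatible M E (\<lambda>x. min x (1 / real (Suc n)))" for n
    by (rule assms(2)) simp
  show "(\<lambda>n. min x (1 / real (Suc n))) \<longlonglongrightarrow> min x 0" for x
    using LIMSEQ_inverse_real_of_nat by (intro tendsto_min tendsto_const) (simp add: inverse_eq_divide)
qed

section \<open>The inequalities of Cipriani and Grillo\<close>

text \<open>
  Taking \<open>f = (u + v) / 2\<close>, \<open>g = (v - u) / 2\<close> gives \<open>(u + u \<and> v) / 2 = f - g\<^sub>+\<close> and
  \<open>(v + u \<or> v) / 2 = f + g\<^sub>+\<close>.
\<close>

lemma compatible_pos_part_iff:
  "compatible M E (\<lambda>x. max 0 x) \<longleftrightarrow>
    (\<forall>u\<in>L2 M. \<forall>v\<in>L2 M.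
      E (\<lambda>x. (u x + min (u x) (v x)) / 2) + E (\<lambda>x. (v x + max (u x) (v x)) / 2) \<le> E u + E v)"
  (is "_ \<longleftrightarrow> ?R")
proof
  assume pos: "compatible M E (\<lambda>x. max 0 x)"
  show ?R
  proof (intro ballI)
    fix u v assume u: "u \<in> L2 M" and v: "v \<in> L2 M"
    define f where "f x = 1 / 2 * (u x + v x)" for x
    define g where "g x = 1 / 2 * (v x - u x)" for x
    have fg: "f \<in> L2 M" "g \<in> L2 M"
      unfolding f_def[abs_def] g_def[abs_def] by (intro L2_scale L2_add L2_diff u v)+
    have "(\<lambda>x. f x + max 0 (g x)) = (\<lambda>x. (v x + max (u x) (v x)) / 2)"
      "(\<lambda>x. f x - max 0 (g x)) = (\<lambda>x. (u x + min (u x) (v x)) / 2)"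
      "(\<lambda>x. f x + g x) = v" "(\<lambda>x. f x - g x) = u"
      by (auto simp: f_def g_def max_def min_def field_simps)
    then show "E (\<lambda>x. (u x + min (u x) (v x)) / 2) + E (\<lambda>x. (v x + max (u x) (v x)) / 2) \<le> E u + E v"
      using compatibleD[OF pos fg] by (simp add: add.commute)
  qed
next
  assume R: ?R
  show "compatible M E (\<lambda>x. max 0 x)"
    unfolding compatible_def
  proof (intro conjI ballI)
    show "normal_contraction (\<lambda>x. max 0 x)"
      by (auto simp: normal_contraction_def max_def)
    fix f g assume f: "f \<in> L2 M" and g: "g \<in> L2 M"
    have "(\<lambda>x. (f x - g x + min (f x - g x) (f x + g x)) / 2) = (\<lambda>x. f x - max 0 (g x))"
      "(\<lambda>x. (f x + g x + max (f x - g x) (f x + g x)) / 2) = (\<lambda>x. f x + max 0 (g x))"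
      by (auto simp: max_def min_def field_simps)
    then show "E (\<lambda>x. f x + max 0 (g x)) + E (\<lambda>x. f x - max 0 (g x))
        \<le> E (\<lambda>x. f x + g x) + E (\<lambda>x. f x - g x)"
      using R[rule_format, OF L2_diff[OF f g] L2_add[OF f g]] by (simp add: add.commute)
  qed
qed

text \<open>
  The bracket in \<open>P\<^sup>1\<close> and \<open>P\<^sup>2\<close> equals \<open>w + (- \<alpha> \<or> w \<and> \<alpha>)\<close> for \<open>w = u - v\<close>, which is where the
  truncation comes from; its level is halved because \<open>g = w / 2\<close>.
\<close>

lemma P_eq_truncation:
  assumes "\<alpha> > 0"
  shows "P1 (2 * \<alpha>) (\<lambda>x. f x + g x) (\<lambda>x. f x - g x) = (\<lambda>x. f x + max (- \<alpha>) (min (g x) \<alpha>))"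
    and "P2 (2 * \<alpha>) (\<lambda>x. f x + g x) (\<lambda>x. f x - g x) = (\<lambda>x. f x - max (- \<alpha>) (min (g x) \<alpha>))"
  using assms by (auto simp: P1_def P2_def max_def min_def field_simps)

lemma compatible_truncation_iff:
  "(\<forall>\<alpha>>0. compatible M E (\<lambda>x. max (- \<alpha>) (min x \<alpha>))) \<longleftrightarrow>
    (\<forall>u\<in>L2 M. \<forall>v\<in>L2 M. \<forall>\<alpha>>0. E (P1 \<alpha> u v) + E (P2 \<alpha> u v) \<le> E u + E v)"
  (is "?L \<longleftrightarrow> ?R")
proof
  assume L: ?L
  show ?R
  proof (intro ballI allI impI)
    fix u v and \<alpha> :: real assume u: "u \<in> L2 M" and v: "v \<in> L2 M" and \<alpha>: "\<alpha> > 0"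
    define f where "f x = 1 / 2 * (u x + v x)" for x
    define g where "g x = 1 / 2 * (u x - v x)" for x
    have fg: "f \<in> L2 M" "g \<in> L2 M"
      unfolding f_def[abs_def] g_def[abs_def] by (intro L2_scale L2_add L2_diff u v)+
    have uv: "(\<lambda>x. f x + g x) = u" "(\<lambda>x. f x - g x) = v"
      by (auto simp: f_def g_def field_simps)
    have "compatible M E (\<lambda>x. max (- (\<alpha> / 2)) (min x (\<alpha> / 2)))"
      using L \<alpha> by (meson half_gt_zero)
    from compatibleD[OF this fg] show "E (P1 \<alpha> u v) + E (P2 \<alpha> u v) \<le> E u + E v"
      using P_eq_truncation[of "\<alpha> / 2" f g] \<alpha> by (simp add: uv)
  qed
next
  assume R: ?R
  show ?L
  proof (intro allI impI)
    fix \<alpha> :: real assume \<alpha>: "\<alpha> > 0"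
    show "compatible M E (\<lambda>x. max (- \<alpha>) (min x \<alpha>))"
      unfolding compatible_def
    proof (intro conjI ballI)
      show "normal_contraction (\<lambda>x. max (- \<alpha>) (min x \<alpha>))"
        using \<alpha> by (auto simp: normal_contraction_def max_def min_def)
      fix f g assume f: "f \<in> L2 M" and g: "g \<in> L2 M"
      have "0 < 2 * \<alpha>" using \<alpha> by simp
      from R[rule_format, OF L2_add[OF f g] L2_diff[OF f g] this]
      show "E (\<lambda>x. f x + max (- \<alpha>) (min (g x) \<alpha>)) + E (\<lambda>x. f x - max (- \<alpha>) (min (g x) \<alpha>))
          \<le> E (\<lambda>x. f x + g x) + E (\<lambda>x. f x - g x)"
        by (simp only: P_eq_truncation[OF \<alpha>])
    qed
  qed
qed

section \<open>Equivalence of the characterisations\<close>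

theorem theorem2:
  fixes M :: "'a measure" and E :: "('a \<Rightarrow> real) \<Rightarrow> ennreal"
  assumes "L2_functional M E"
    and "proper_functional M E"
    and "lsc_functional M E"
    and "convex_functional M E"
  defines "i \<equiv> nonlinear_Dirichlet_form M E"
    and "ii \<equiv> compatible M E (\<lambda>x. max 0 x) \<and>
               (\<forall>\<alpha>>0. compatible M E (\<lambda>x. max (- \<alpha>) (min x \<alpha>)))"
    and "iii \<equiv> \<forall>\<alpha>\<ge>0. compatible M E (\<lambda>x. min x \<alpha>)"
    and "iii' \<equiv> \<forall>\<alpha>>0. compatible M E (\<lambda>x. min x \<alpha>)"
    and "iv \<equiv> \<forall>\<alpha>>0. compatible M E (\<lambda>x. max 0 (min x \<alpha>))"
  shows "(i \<longleftrightarrow> ii) \<and> (ii \<longleftrightarrow> iii) \<and> (iii \<longleftrightarrow> iii') \<and> (iii' \<longleftrightarrow> iv)"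
proof -
  note lsc = assms(3)
  have "i \<longleftrightarrow> ii"
    unfolding i_def ii_def nonlinear_Dirichlet_form_def compatible_pos_part_iff compatible_truncation_iff
    using assms(1-4) by simp
  moreover have "ii \<Longrightarrow> iv"
  proof -
    assume ii
    then have "compatible M E (\<lambda>x. max 0 (max (- \<alpha>) (min x \<alpha>)))" if "\<alpha> > 0" for \<alpha>
      using that compatible_comp unfolding ii_def by blast
    moreover have "(\<lambda>x. max 0 (max (- \<alpha>) (min x \<alpha>))) = (\<lambda>x. max 0 (min x \<alpha>))" if "\<alpha> > 0" for \<alpha> :: real
      using that by auto
    ultimately show iv unfolding iv_def by simp
  qed
  moreover have "iv \<Longrightarrow> iii'"
  proof -
    assume iv
    then have cut: "compatible M E (\<lambda>x. max 0 (min x \<alpha>))" if "\<alpha> > 0" for \<alpha>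
      using that unfolding iv_def by blast
    show iii'
      unfolding iii'_def
      using compatible_min_of_compatible_interval_cut[OF lsc
          compatible_pos_part_of_compatible_interval_cut[OF lsc cut] cut] by simp
  qed
  moreover have "iii' \<Longrightarrow> iii"
  proof -
    assume iii'
    then have *: "compatible M E (\<lambda>x. min x \<alpha>)" if "\<alpha> > 0" for \<alpha>
      using that unfolding iii'_def by blast
    show iii
      unfolding iii_def using * compatible_min_zero[OF lsc *] by (metis order_le_less)
  qed
  moreover have "iii \<Longrightarrow> ii"
  proof -
    assume iii
    then have mn: "compatible M E (\<lambda>x. min x \<alpha>)" if "\<alpha> \<ge> 0" for \<alpha>
      using that unfolding iii_def by blast
    have mx: "compatible M E (\<lambda>x. max (- \<alpha>) x)" if "\<alpha> \<ge> 0" for \<alpha>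
    proof -
      have "(\<lambda>x. - min (- x) \<alpha>) = (\<lambda>x. max (- \<alpha>) x)" by auto
      then show ?thesis using compatible_reflect[OF mn[OF that]] by simp
    qed
    have "compatible M E (\<lambda>x. max (- \<alpha>) (min x \<alpha>))" if "\<alpha> > 0" for \<alpha>
      using compatible_comp[OF mx[of \<alpha>] mn[of \<alpha>]] that by simp
    then show ii unfolding ii_def using mx[of 0] by simp
  qed
  ultimately show ?thesis by blast
qed

end
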